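(* The logic $\mathbf{IL}\mathsf{P_0W^*}$ does not prove the principle $\mathsf{R}$; that is, not every instance of the schema $$\mathsf R:\quad (A\rhd B)\rightarrow\bigl(\neg(A\rhd\neg C)\rhd (B\wedge\Box C)\bigr)$$ is a theorem of $\mathbf{IL}\mathsf{P_0W^*}$.
   Context: Modal formulas are built from $\bot$ and countably many propositional variables using $\rightarrow$, the unary modality $\Box$ and the binary modality $\rhd$; other boolean connectives are defined as usual and $\Diamond A:=\neg\Box\neg A$. $\mathbf{IL}$ is the smallest set of formulas containing all propositional tautologies and all instances of the schemata below and closed under Modus Ponens and Necessitation (from $A$ infer $\Box A$): L1: $\Box(A\rightarrow B)\rightarrow(\Box A\rightarrow\Box B)$; L2: $\Box A\rightarrow\Box\Box A$; L3: $\Box(\Box A\rightarrow A)\rightarrow\Box A$; J1: $\Box(A\rightarrow B)\rightarrow (A\rhd B)$; J2: $(A\rhd B)\wedge(B\rhd C)\rightarrow (A\rhd C)$; J3: $(A\rhd C)\wedge(B\rhd C)\rightarrow ((A\vee B)\rhd C)$; J4: $(A\rhd B)\rightarrow(\Diamond A\rightarrow\Diamond B)$; J5: $\Diamond A\rhd A$. $\mathbf{IL}\mathsf{P_0W^*}$ is the logic obtained by adding to $\mathbf{IL}$ (with the same rules) all instances of $\mathsf{P_0}$: $(A\rhd\Diamond B)\rightarrow\Box(A\rhd B)$, and $\mathsf{W^*}$: $(A\rhd B)\rightarrow\bigl((B\wedge\Box C)\rhd(B\wedge\Box C\wedge\Box\neg A)\bigr)$. *)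

theory Defs
  imports Main
begin

datatype fm =
    Fls  ("\<^bold>\<bottom>")
  | Var nat
  | Imp fm fm  (infixr "\<^bold>\<rightarrow>" 55)
  | Box fm  ("\<^bold>\<box> _" [80] 80)
  | Rhd fm fm  (infix "\<^bold>\<rhd>" 60)

abbreviation Neg :: "fm \<Rightarrow> fm"  ("\<^bold>\<not> _" [80] 80)
  where "\<^bold>\<not> A \<equiv> A \<^bold>\<rightarrow> \<^bold>\<bottom>"

abbreviation Or :: "fm \<Rightarrow> fm \<Rightarrow> fm"  (infixr "\<^bold>\<or>" 65)
  where "A \<^bold>\<or> B \<equiv> \<^bold>\<not> A \<^bold>\<rightarrow> B"

abbreviation And :: "fm \<Rightarrow> fm \<Rightarrow> fm"  (infixr "\<^bold>\<and>" 70)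
  where "A \<^bold>\<and> B \<equiv> \<^bold>\<not> (A \<^bold>\<rightarrow> \<^bold>\<not> B)"

abbreviation Dia :: "fm \<Rightarrow> fm"  ("\<^bold>\<diamond> _" [80] 80)
  where "\<^bold>\<diamond> A \<equiv> \<^bold>\<not> (\<^bold>\<box> (\<^bold>\<not> A))"

text \<open>Classical truth of a formula whose outermost modal subformulas are treated as atoms
  valued by \<open>v\<close>; thus \<open>tautology\<close> covers all substitution instances, in the modal language,
  of classical propositional tautologies.\<close>

primrec peval :: "(fm \<Rightarrow> bool) \<Rightarrow> fm \<Rightarrow> bool" where
  "peval v \<^bold>\<bottom> = False"
| "peval v (Var n) = v (Var n)"
| "peval v (A \<^bold>\<rightarrow> B) = (peval v A \<longrightarrow> peval v B)"
| "peval v (\<^bold>\<box> A) = v (\<^bold>\<box> A)"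
| "peval v (A \<^bold>\<rhd> B) = v (A \<^bold>\<rhd> B)"

definition tautology :: "fm \<Rightarrow> bool" where
  "tautology A \<longleftrightarrow> (\<forall>v. peval v A)"

text \<open>\<open>IL_plus X\<close> is \<open>IL\<close> with the formulas in \<open>X\<close> added as axioms. Necessitation applies to all
  theorems, including those derived from \<open>X\<close>. There is no substitution rule, so a schema is
  added as the set of all its instances.\<close>

inductive_set IL_plus :: "fm set \<Rightarrow> fm set" for X :: "fm set" where
  Taut: "tautology A \<Longrightarrow> A \<in> IL_plus X"
| L1: "\<^bold>\<box> (A \<^bold>\<rightarrow> B) \<^bold>\<rightarrow> (\<^bold>\<box> A \<^bold>\<rightarrow> \<^bold>\<box> B) \<in> IL_plus X"
| L2: "\<^bold>\<box> A \<^bold>\<rightarrow> \<^bold>\<box> (\<^bold>\<box> A) \<in> IL_plus X"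
| L3: "\<^bold>\<box> (\<^bold>\<box> A \<^bold>\<rightarrow> A) \<^bold>\<rightarrow> \<^bold>\<box> A \<in> IL_plus X"
| J1: "\<^bold>\<box> (A \<^bold>\<rightarrow> B) \<^bold>\<rightarrow> (A \<^bold>\<rhd> B) \<in> IL_plus X"
| J2: "((A \<^bold>\<rhd> B) \<^bold>\<and> (B \<^bold>\<rhd> C)) \<^bold>\<rightarrow> (A \<^bold>\<rhd> C) \<in> IL_plus X"
| J3: "((A \<^bold>\<rhd> C) \<^bold>\<and> (B \<^bold>\<rhd> C)) \<^bold>\<rightarrow> ((A \<^bold>\<or> B) \<^bold>\<rhd> C) \<in> IL_plus X"
| J4: "(A \<^bold>\<rhd> B) \<^bold>\<rightarrow> (\<^bold>\<diamond> A \<^bold>\<rightarrow> \<^bold>\<diamond> B) \<in> IL_plus X"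
| J5: "(\<^bold>\<diamond> A) \<^bold>\<rhd> A \<in> IL_plus X"
| Extra: "A \<in> X \<Longrightarrow> A \<in> IL_plus X"
| MP: "A \<^bold>\<rightarrow> B \<in> IL_plus X \<Longrightarrow> A \<in> IL_plus X \<Longrightarrow> B \<in> IL_plus X"
| Nec: "A \<in> IL_plus X \<Longrightarrow> \<^bold>\<box> A \<in> IL_plus X"

definition IL :: "fm set" where
  "IL = IL_plus {}"

definition P0_schema :: "fm set" where
  "P0_schema = {(A \<^bold>\<rhd> (\<^bold>\<diamond> B)) \<^bold>\<rightarrow> \<^bold>\<box> (A \<^bold>\<rhd> B) | A B. True}"

definition Wstar_schema :: "fm set" where
  "Wstar_schema =
     {(A \<^bold>\<rhd> B) \<^bold>\<rightarrow> ((B \<^bold>\<and> \<^bold>\<box> C) \<^bold>\<rhd> (B \<^bold>\<and> \<^bold>\<box> C \<^bold>\<and> \<^bold>\<box> (\<^bold>\<not> A))) | A B C. True}"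

definition R_schema :: "fm set" where
  "R_schema =
     {(A \<^bold>\<rhd> B) \<^bold>\<rightarrow> ((\<^bold>\<not> (A \<^bold>\<rhd> (\<^bold>\<not> C))) \<^bold>\<rhd> (B \<^bold>\<and> \<^bold>\<box> C)) | A B C. True}"

definition ILP0Wstar :: "fm set" where
  "ILP0Wstar = IL_plus (P0_schema \<union> Wstar_schema)"

end

theory Submission
  imports Defs
begin

text \<open>\<open>P\<^sub>0\<close> and \<open>R\<close> hold on the same ordinary Veltman frames, so the countermodel is a generalised
  Veltman model, in which \<open>S\<^sub>w\<close> relates worlds to sets of worlds. Its heart is the single relation
  \<open>Y S\<^sub>W {Z1, Z2}\<close>, where \<open>Zi\<close> sees only \<open>Ui\<close> and \<open>X\<close> sees \<open>Y\<close>, \<open>U1\<close> and \<open>U2\<close>. Principle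
  \<open>P\<^sub>0\<close> only forces \<open>Y S\<^sub>X {U1, U2}\<close>. For \<open>R\<close> with \<open>A = {Y}\<close>, \<open>B = {Z1, Z2}\<close> and \<open>C = {Y, U1}\<close>,
  the world \<open>X\<close> satisfies \<open>\<not> (A \<rhd> \<not> C)\<close>, but only \<open>Z1\<close> satisfies \<open>B \<and> \<box> C\<close>, and \<open>X S\<^sub>W {Z1}\<close>
  fails.\<close>

datatype world = W | X | Y | Z1 | Z2 | U1 | U2

primrec acc :: "world \<Rightarrow> world set" where
  "acc W = {X, Y, Z1, Z2, U1, U2}"
| "acc X = {Y, U1, U2}"
| "acc Y = {}"
| "acc Z1 = {U1}"
| "acc Z2 = {U2}"
| "acc U1 = {}"
| "acc U2 = {}"

text \<open>\<open>cl w V\<close> is the set of all \<open>v\<close> with \<open>v S\<^sub>w V\<close>. Quasi-reflexivity, monotonicity and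
  quasi-transitivity of \<open>S\<^sub>w\<close> amount to \<open>cl w\<close> being a closure operator on \<open>acc w\<close>.\<close>

inductive_set cl :: "world \<Rightarrow> world set \<Rightarrow> world set" for w V where
  base: "v \<in> acc w \<Longrightarrow> v \<in> V \<Longrightarrow> v \<in> cl w V"
| step: "v \<in> acc w \<Longrightarrow> u \<in> acc v \<Longrightarrow> u \<in> cl w V \<Longrightarrow> v \<in> cl w V"
| pair_W: "w = W \<Longrightarrow> Z1 \<in> cl w V \<Longrightarrow> Z2 \<in> cl w V \<Longrightarrow> Y \<in> cl w V"
| pair_X: "w = X \<Longrightarrow> U1 \<in> cl w V \<Longrightarrow> U2 \<in> cl w V \<Longrightarrow> Y \<in> cl w V"

primrec sat :: "(nat \<Rightarrow> world set) \<Rightarrow> world \<Rightarrow> fm \<Rightarrow> bool" where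
  "sat val w \<^bold>\<bottom> \<longleftrightarrow> False"
| "sat val w (Var n) \<longleftrightarrow> w \<in> val n"
| "sat val w (A \<^bold>\<rightarrow> B) \<longleftrightarrow> (sat val w A \<longrightarrow> sat val w B)"
| "sat val w (\<^bold>\<box> A) \<longleftrightarrow> (\<forall>v \<in> acc w. sat val v A)"
| "sat val w (A \<^bold>\<rhd> B) \<longleftrightarrow> (\<forall>v \<in> acc w. sat val v A \<longrightarrow> v \<in> cl w {u. sat val u B})"

lemma acc_trans: "v \<in> acc w \<Longrightarrow> u \<in> acc v \<Longrightarrow> u \<in> acc w"
  by (cases w; cases v) auto

text \<open>\<open>acc\<close> has no cycles, so A spreads upwards from the dead ends.\<close>

lemma sat_Loeb:
  assumes "\<forall>v \<in> acc w. (\<forall>u \<in> acc v. sat val u A) \<longrightarrow> sat val v A"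
  shows "\<forall>v \<in> acc w. sat val v A"
  using assms by (cases w) auto

lemma cl_trans: "v \<in> cl w V \<Longrightarrow> V \<inter> acc w \<subseteq> cl w V' \<Longrightarrow> v \<in> cl w V'"
  by (induction rule: cl.induct) (auto intro: cl.intros)

lemma cl_nonempty: "v \<in> cl w V \<Longrightarrow> \<exists>u \<in> acc w. u \<in> V"
  by (induction rule: cl.induct) auto

lemma cl_U: "U1 \<in> cl w V \<longleftrightarrow> U1 \<in> acc w \<and> U1 \<in> V" "U2 \<in> cl w V \<longleftrightarrow> U2 \<in> acc w \<and> U2 \<in> V"
  by (auto elim: cl.cases intro: cl.base)

lemma cl_W_Z: "Z1 \<in> cl W V \<longleftrightarrow> Z1 \<in> V \<or> U1 \<in> V" "Z2 \<in> cl W V \<longleftrightarrow> Z2 \<in> V \<or> U2 \<in> V"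
  by (auto simp: cl_U elim: cl.cases intro: cl.base cl.step[of Z1 W U1] cl.step[of Z2 W U2])

lemma cl_W_Y: "Y \<in> cl W V \<longleftrightarrow> Y \<in> V \<or> Z1 \<in> cl W V \<and> Z2 \<in> cl W V"
  by (auto elim: cl.cases intro: cl.base cl.pair_W)

lemma cl_W_X: "X \<in> cl W V \<longleftrightarrow> X \<in> V \<or> Y \<in> cl W V \<or> U1 \<in> V \<or> U2 \<in> V"
proof
  assume "X \<in> cl W V"
  then show "X \<in> V \<or> Y \<in> cl W V \<or> U1 \<in> V \<or> U2 \<in> V"
    by (cases rule: cl.cases) (auto simp: cl_U)
qed (auto simp: cl_U intro: cl.base cl.step[of X W Y] cl.step[of X W U1] cl.step[of X W U2])

lemma cl_X_Y: "Y \<in> cl X V \<longleftrightarrow> Y \<in> V \<or> U1 \<in> V \<and> U2 \<in> V"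
  by (auto simp: cl_U elim: cl.cases intro: cl.base cl.pair_X)

lemmas cl_simps = cl_U cl_W_Z cl_W_Y cl_W_X cl_X_Y

text \<open>Each \<open>Zi\<close> sees only \<open>Ui\<close>, so \<diamond>B at \<open>Z1\<close>
  and \<open>Z2\<close> puts B at \<open>U1\<close> and \<open>U2\<close>, and \<open>pair_X\<close>
  applies.\<close>

lemma sat_P0: "sat val w ((A \<^bold>\<rhd> (\<^bold>\<diamond> B)) \<^bold>\<rightarrow> \<^bold>\<box> (A \<^bold>\<rhd> B))"
  by (cases w) (auto simp: cl_simps)

text \<open>The critical case is \<open>X\<close> below \<open>W\<close>: \<open>X\<close> sees
  \<open>U1\<close> and \<open>U2\<close>, so its \<box>C passes to \<open>Z1\<close> and
  \<open>Z2\<close>. If A holds at some \<open>Ui\<close>, so does B, and this dead end serves as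
  target.\<close>

lemma sat_Wstar:
  "sat val w ((A \<^bold>\<rhd> B) \<^bold>\<rightarrow> ((B \<^bold>\<and> \<^bold>\<box> C) \<^bold>\<rhd> (B \<^bold>\<and> \<^bold>\<box> C \<^bold>\<and> \<^bold>\<box> (\<^bold>\<not> A))))"
  by (cases w) (auto simp: cl_simps)

lemma peval_sat: "peval (sat val w) A \<longleftrightarrow> sat val w A"
  by (induction A) auto

lemma soundness:
  assumes "A \<in> ILP0Wstar"
  shows "sat val w A"
  using assms unfolding ILP0Wstar_def
proof (induction arbitrary: w rule: IL_plus.induct)
  case (Taut A)
  then show ?case using peval_sat unfolding tautology_def by blast
next
  case (L2 A)
  then show ?case using acc_trans by auto
next
  case (L3 A)
  then show ?case using sat_Loeb by simp
next
  case (J1 A B)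
  then show ?case by (auto intro: cl.base)
next
  case (J2 A B C)
  then show ?case by (auto elim!: cl_trans)
next
  case (J4 A B)
  then show ?case by (auto dest: cl_nonempty)
next
  case (J5 A)
  then show ?case by (auto intro: cl.base cl.step acc_trans)
next
  case (Extra A)
  then show ?case using sat_P0 sat_Wstar unfolding P0_schema_def Wstar_schema_def by blast
qed auto

theorem theorem4p3:
  shows "\<not> (R_schema \<subseteq> ILP0Wstar)"
proof
  define val :: "nat \<Rightarrow> world set"
    where "val = (\<lambda>_. {})(0 := {Y}, 1 := {Z1, Z2}, 2 := {Y, U1})"
  let ?R = "(Var 0 \<^bold>\<rhd> Var 1) \<^bold>\<rightarrow> ((\<^bold>\<not> (Var 0 \<^bold>\<rhd> (\<^bold>\<not> (Var 2)))) \<^bold>\<rhd> (Var 1 \<^bold>\<and> \<^bold>\<box> (Var 2)))"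
  assume "R_schema \<subseteq> ILP0Wstar"
  moreover have "?R \<in> R_schema"
    unfolding R_schema_def by blast
  ultimately have "sat val W ?R"
    using soundness by blast
  then show False
    \<comment> \<open>\<open>cl W {Z1}\<close> is just \<open>{Z1}\<close>: \<open>pair_W\<close>
      would need \<open>Z2\<close> too.\<close>
    by (simp add: val_def cl_simps)
qed

end
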